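(* Let the statistics $\eta_{K,M}^{(1)},\eta_{K,M}^{(2)}$ and their local running-consensus estimators $\hat\eta_{K,M,j}^{(1)},\hat\eta_{K,M,j}^{(2)}$ at sensor $j$ be as defined in the context, with weight matrices $\check{\mathbf W},\mathbf W,\widetilde{\mathbf W}\in\mathbb{R}^{N\times N}$ each satisfying $\mathbf 1^T\mathbf V=\mathbf 1^T$, $\mathbf V\mathbf 1=\mathbf 1$ and $0<\sigma_2(\mathbf V)<1$ for $\mathbf V\in\{\check{\mathbf W},\mathbf W,\widetilde{\mathbf W}\}$, and with $Q\ge1$ message-passing rounds per sampling interval. Let $q(\theta)=F(\tau-\theta)$. For any given $K<\infty$ and any sensor $j$, $$\lim_{M\to\infty}\left|\hat\eta_{K,M,j}^{(1)}-\eta_{K,M}^{(1)}\right|\le\frac{N^2[2-q(\theta)]}{q(\theta)[1-q(\theta)]}\left(\frac{2[\sigma_2(\check{\mathbf W})]^Q}{1-[\sigma_2(\check{\mathbf W})]^Q}+\frac{[\sigma_2(\widetilde{\mathbf W})]^Q}{1-[\sigma_2(\widetilde{\mathbf W})]^Q}+\frac{[\sigma_2(\mathbf W)]^Q}{1-[\sigma_2(\mathbf W)]^Q}\right)\quad\text{a.s.}$$ and $$\lim_{M\to\infty}\left|\hat\eta_{K,M,j}^{(2)}-\eta_{K,M}^{(2)}\right|=0\quad\text{a.s.}$$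
   Context: Model. $\mathcal{N}=\{1,\dots,N\}$ is a set of sensors, partitioned into a set $\mathcal{S}$ of $N_{\mathcal{S}}$ secure sensors (possibly empty) and a set $\mathcal{A}=\mathcal{N}\setminus\mathcal{S}$ of insecure sensors. $F$ is the common cdf of the i.i.d. additive noise; $F$ is invertible, i.e. a continuous strictly increasing bijection $\mathbb{R}\to(0,1)$. $\tau\in\mathbb{R}$ is the quantizer threshold, $\theta\in\mathbb{R}$ an unknown deterministic parameter. An unattacked sensor at each time observes $x=\theta+n$ (noise $n$ with cdf $F$) and outputs the bit $\mathbf{1}\{x>\tau\}$; an attacked sensor $j\in\mathcal{A}$ does the same with $x=\theta+\mu_j+n$, $\mu_j\ge b>0$ deterministic. All noise samples are independent. The bits in an initial secure (attack-free) period of length $M$ are $\check u_j^{(m)}\in\{0,1\}$, $m=1,\dots,M$; the bits after the secure period are relabeled $u_j^{(k)}\in\{0,1\}$, $k=1,2,\dots$ (sensors in $\mathcal{A}$ may or may not be attacked from some time on). In the limit $M\to\infty$, $(\check u_j^{(m)})_{m\ge1}$ are infinite i.i.d. sequences with $\Pr(\check u_j^{(m)}=0)=F(\tau-\theta)$, and the bits $u_j^{(i)}$, $1\le i\le K$, are held as given. Notation: $\mathbf 1$ is the all-one vector, $\mathbf e_j$ the $j$-th standard basis vector of $\mathbb{R}^N$, and $\sigma_i(\cdot)$ the $i$-th largest singular value. Statistics: $$\lambda_{\mathcal M}=\sum_{j\in\mathcal{N}}\sum_{m=1}^M\check u_j^{(m)},\quad \lambda_{\mathcal N}=\sum_{j\in\mathcal{N}}\sum_{i=1}^Ku_j^{(i)},\quad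 \lambda_{\mathcal S}=\sum_{j\in\mathcal{S}}\sum_{i=1}^Ku_j^{(i)},$$ $$G_{K,M}^{(1)}=\ln\frac{1-\frac{\lambda_{\mathcal M}+\lambda_{\mathcal S}}{MN+KN_{\mathcal S}}}{1-\frac{\lambda_{\mathcal M}+\lambda_{\mathcal N}}{MN+KN}},\qquad G_{K,M}^{(2)}=\ln\frac{\frac{\lambda_{\mathcal M}+\lambda_{\mathcal S}}{MN+KN_{\mathcal S}}}{\frac{\lambda_{\mathcal M}+\lambda_{\mathcal N}}{MN+KN}},$$ $$\eta_{K,M}^{(1)}=(MN-\lambda_{\mathcal M})G_{K,M}^{(1)}+\lambda_{\mathcal M}G_{K,M}^{(2)},\qquad \eta_{K,M}^{(2)}=(KN_{\mathcal S}-\lambda_{\mathcal S})G_{K,M}^{(1)}+\lambda_{\mathcal S}G_{K,M}^{(2)}.$$ Running consensus. For $l\ge1$ define vectors in $\mathbb{R}^N$ by: $\check\gamma_j^{(l)}=\check u_j^{(l)}$ if $l\le M$ and $0$ otherwise; $\gamma_j^{(l)}=u_j^{(l-M)}$ if $l\ge M+1$ and $0$ otherwise; $\widetilde\gamma_j^{(l)}=u_j^{(l-M)}$ if $l\ge M+1$ and $j\in\mathcal S$, and $0$ otherwise. With $\check{\mathbf W},\mathbf W,\widetilde{\mathbf W}$ fixed (not depending on $M$), set for $L\ge1$ $$\check{\boldsymbol\Gamma}^{(L)}=\sum_{l=1}^L\check{\mathbf W}^{Q(L-l+1)}\check{\boldsymbol\gamma}^{(l)},\quad \boldsymbol\Gamma^{(L)}=\sum_{l=1}^L\mathbf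 W^{Q(L-l+1)}\boldsymbol\gamma^{(l)},\quad \widetilde{\boldsymbol\Gamma}^{(L)}=\sum_{l=1}^L\widetilde{\mathbf W}^{Q(L-l+1)}\widetilde{\boldsymbol\gamma}^{(l)}.$$ Local estimators at sensor $j$: $\hat\lambda_{\mathcal M,j}^{(K)}=N\mathbf e_j^T\check{\boldsymbol\Gamma}^{(M+K)}$, $\hat\lambda_{\mathcal N,j}^{(K)}=N\mathbf e_j^T\boldsymbol\Gamma^{(M+K)}$, $\hat\lambda_{\mathcal S,j}^{(K)}=N\mathbf e_j^T\widetilde{\boldsymbol\Gamma}^{(M+K)}$; $$\hat G_{K,M}^{(j,1)}=\ln\frac{1-\frac{\hat\lambda_{\mathcal M,j}^{(K)}+\hat\lambda_{\mathcal S,j}^{(K)}}{MN+KN_{\mathcal S}}}{1-\frac{\hat\lambda_{\mathcal M,j}^{(K)}+\hat\lambda_{\mathcal N,j}^{(K)}}{MN+KN}},\qquad \hat G_{K,M}^{(j,2)}=\ln\frac{\frac{\hat\lambda_{\mathcal M,j}^{(K)}+\hat\lambda_{\mathcal S,j}^{(K)}}{MN+KN_{\mathcal S}}}{\frac{\hat\lambda_{\mathcal M,j}^{(K)}+\hat\lambda_{\mathcal N,j}^{(K)}}{MN+KN}},$$ $$\hat\eta_{K,M,j}^{(1)}=(MN-\hat\lambda_{\mathcal M,j}^{(K)})\hat G_{K,M}^{(j,1)}+\hat\lambda_{\mathcal M,j}^{(K)}\hat G_{K,M}^{(j,2)},\qquad \hat\eta_{K,M,j}^{(2)}=(KN_{\mathcal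 S}-\hat\lambda_{\mathcal S,j}^{(K)})\hat G_{K,M}^{(j,1)}+\hat\lambda_{\mathcal S,j}^{(K)}\hat G_{K,M}^{(j,2)}.$$ (Almost surely, all these quantities are well defined for all sufficiently large $M$.) *)

theory Defs
  imports "HOL-Probability.Probability" "HOL-Library.Multiset"
begin

section \<open>Singular values of a square real matrix\<close>

definition sv_eigenspace :: "real ^ 'n ^ 'n \<Rightarrow> real \<Rightarrow> (real ^ 'n) set" where
  "sv_eigenspace A s = {x. (transpose A ** A) *v x = s\<^sup>2 *\<^sub>R x}"

text \<open>
  The singular values of \<open>A\<close> are the nonnegative square roots \<open>s\<close> of the eigenvalues of
  \<open>transpose A ** A\<close>, listed with multiplicity. As that matrix is symmetric, the geometric
  multiplicity used here agrees with the algebraic one; the index set of the sum is finite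
  because eigenvectors to distinct eigenvalues are orthogonal.
\<close>

definition singular_values :: "real ^ 'n ^ 'n \<Rightarrow> real multiset" where
  "singular_values A =
     (\<Sum>s\<in>{s. 0 \<le> s \<and> (\<exists>x. x \<noteq> 0 \<and> x \<in> sv_eigenspace A s)}.
        replicate_mset (dim (sv_eigenspace A s)) s)"

text \<open>
  The \<open>i\<close>-th largest singular value, counting from \<open>i = 1\<close>. The value is \<open>0\<close> if there are fewer
  than \<open>i\<close> singular values, so \<open>sing_val 2 A > 0\<close> forces the dimension to be at least 2.
\<close>

definition sing_val :: "nat \<Rightarrow> real ^ 'n ^ 'n \<Rightarrow> real" where
  "sing_val i A =
     (if 1 \<le> i \<and> i \<le> size (singular_values A)
      then rev (sorted_list_of_multiset (singular_values A)) ! (i - 1) else 0)"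


section \<open>Running consensus\<close>

text \<open>The power \<open>A ^ k\<close> of the library is the componentwise one, hence a separate matrix power.\<close>

definition mat_pow :: "real ^ 'n ^ 'n \<Rightarrow> nat \<Rightarrow> real ^ 'n ^ 'n" where
  "mat_pow A k = (((**) A) ^^ k) (mat 1)"

definition consensus_weights :: "real ^ 'n ^ 'n \<Rightarrow> bool" where
  "consensus_weights V \<longleftrightarrow>
     1 v* V = 1 \<and> V *v 1 = 1 \<and> 0 < sing_val 2 V \<and> sing_val 2 V < 1"

definition ratio_term :: "nat \<Rightarrow> real ^ 'n ^ 'n \<Rightarrow> real" where
  "ratio_term Q V = sing_val 2 V ^ Q / (1 - sing_val 2 V ^ Q)"

definition consensus_state ::
    "real ^ 'n ^ 'n \<Rightarrow> nat \<Rightarrow> (nat \<Rightarrow> real ^ 'n) \<Rightarrow> nat \<Rightarrow> real ^ 'n" where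
  "consensus_state V Q g L = (\<Sum>l=1..L. mat_pow V (Q * (L - l + 1)) *v g l)"

text \<open>
  In what follows \<open>c j m\<close> (\<open>m \<ge> 1\<close>) is the \<open>m\<close>-th bit of sensor \<open>j\<close> in the secure period of
  length \<open>M\<close>, and \<open>u j k\<close> (\<open>k \<ge> 1\<close>) is its \<open>k\<close>-th bit after that period.
\<close>

definition input_M :: "('n \<Rightarrow> nat \<Rightarrow> real) \<Rightarrow> nat \<Rightarrow> nat \<Rightarrow> real ^ 'n" where
  "input_M c M l = (\<chi> j. if l \<le> M then c j l else 0)"

definition input_N :: "('n \<Rightarrow> nat \<Rightarrow> real) \<Rightarrow> nat \<Rightarrow> nat \<Rightarrow> real ^ 'n" where
  "input_N u M l = (\<chi> j. if l \<ge> M + 1 then u j (l - M) else 0)"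

definition input_S :: "'n set \<Rightarrow> ('n \<Rightarrow> nat \<Rightarrow> real) \<Rightarrow> nat \<Rightarrow> nat \<Rightarrow> real ^ 'n" where
  "input_S S u M l = (\<chi> j. if l \<ge> M + 1 \<and> j \<in> S then u j (l - M) else 0)"


section \<open>Bit counts and their local estimators\<close>

definition lam_M :: "('n::finite \<Rightarrow> nat \<Rightarrow> real) \<Rightarrow> nat \<Rightarrow> real" where
  "lam_M c M = (\<Sum>j\<in>UNIV. \<Sum>m=1..M. c j m)"

definition lam_N :: "('n::finite \<Rightarrow> nat \<Rightarrow> real) \<Rightarrow> nat \<Rightarrow> real" where
  "lam_N u K = (\<Sum>j\<in>UNIV. \<Sum>i=1..K. u j i)"

definition lam_S :: "'n::finite set \<Rightarrow> ('n \<Rightarrow> nat \<Rightarrow> real) \<Rightarrow> nat \<Rightarrow> real" where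
  "lam_S S u K = (\<Sum>j\<in>S. \<Sum>i=1..K. u j i)"

definition lam_M_hat ::
    "real ^ 'n ^ 'n \<Rightarrow> nat \<Rightarrow> ('n \<Rightarrow> nat \<Rightarrow> real) \<Rightarrow> nat \<Rightarrow> nat \<Rightarrow> 'n \<Rightarrow> real" where
  "lam_M_hat V Q c K M j =
     real CARD('n) * (consensus_state V Q (input_M c M) (M + K) $ j)"

definition lam_N_hat ::
    "real ^ 'n ^ 'n \<Rightarrow> nat \<Rightarrow> ('n \<Rightarrow> nat \<Rightarrow> real) \<Rightarrow> nat \<Rightarrow> nat \<Rightarrow> 'n \<Rightarrow> real" where
  "lam_N_hat V Q u K M j =
     real CARD('n) * (consensus_state V Q (input_N u M) (M + K) $ j)"

definition lam_S_hat ::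
    "real ^ 'n ^ 'n \<Rightarrow> nat \<Rightarrow> 'n set \<Rightarrow> ('n \<Rightarrow> nat \<Rightarrow> real) \<Rightarrow> nat \<Rightarrow> nat \<Rightarrow> 'n \<Rightarrow> real" where
  "lam_S_hat V Q S u K M j =
     real CARD('n) * (consensus_state V Q (input_S S u M) (M + K) $ j)"


section \<open>The test statistics\<close>

text \<open>
  The statistics and their local estimators are the same functions of the three counts, so the
  formulas are stated once: \<open>x\<close>, \<open>y\<close>, \<open>z\<close> stand for the counts indexed by \<open>M\<close>, \<open>N\<close>, \<open>S\<close>, and
  \<open>S\<close> is the set of secure sensors.
\<close>

definition G1 :: "'n::finite set \<Rightarrow> nat \<Rightarrow> nat \<Rightarrow> real \<Rightarrow> real \<Rightarrow> real \<Rightarrow> real" where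
  "G1 S K M x y z =
     ln ((1 - (x + z) / (real M * real CARD('n) + real K * real (card S))) /
         (1 - (x + y) / (real M * real CARD('n) + real K * real CARD('n))))"

definition G2 :: "'n::finite set \<Rightarrow> nat \<Rightarrow> nat \<Rightarrow> real \<Rightarrow> real \<Rightarrow> real \<Rightarrow> real" where
  "G2 S K M x y z =
     ln (((x + z) / (real M * real CARD('n) + real K * real (card S))) /
         ((x + y) / (real M * real CARD('n) + real K * real CARD('n))))"

definition eta1_of :: "'n::finite set \<Rightarrow> nat \<Rightarrow> nat \<Rightarrow> real \<Rightarrow> real \<Rightarrow> real \<Rightarrow> real" where
  "eta1_of S K M x y z =
     (real M * real CARD('n) - x) * G1 S K M x y z + x * G2 S K M x y z"

definition eta2_of :: "'n::finite set \<Rightarrow> nat \<Rightarrow> nat \<Rightarrow> real \<Rightarrow> real \<Rightarrow> real \<Rightarrow> real" where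
  "eta2_of S K M x y z =
     (real K * real (card S) - z) * G1 S K M x y z + z * G2 S K M x y z"

definition eta1 ::
    "'n::finite set \<Rightarrow> ('n \<Rightarrow> nat \<Rightarrow> real) \<Rightarrow> ('n \<Rightarrow> nat \<Rightarrow> real) \<Rightarrow> nat \<Rightarrow> nat \<Rightarrow> real" where
  "eta1 S c u K M = eta1_of S K M (lam_M c M) (lam_N u K) (lam_S S u K)"

definition eta2 ::
    "'n::finite set \<Rightarrow> ('n \<Rightarrow> nat \<Rightarrow> real) \<Rightarrow> ('n \<Rightarrow> nat \<Rightarrow> real) \<Rightarrow> nat \<Rightarrow> nat \<Rightarrow> real" where
  "eta2 S c u K M = eta2_of S K M (lam_M c M) (lam_N u K) (lam_S S u K)"

text \<open>The three weight matrices are those used for the counts indexed by \<open>M\<close>, \<open>N\<close>, \<open>S\<close>, in this order.\<close>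

definition eta1_hat ::
    "real ^ 'n ^ 'n \<Rightarrow> real ^ 'n ^ 'n \<Rightarrow> real ^ 'n ^ 'n \<Rightarrow> nat \<Rightarrow> 'n::finite set \<Rightarrow>
     ('n \<Rightarrow> nat \<Rightarrow> real) \<Rightarrow> ('n \<Rightarrow> nat \<Rightarrow> real) \<Rightarrow> nat \<Rightarrow> nat \<Rightarrow> 'n \<Rightarrow> real" where
  "eta1_hat Wc W Wt Q S c u K M j =
     eta1_of S K M (lam_M_hat Wc Q c K M j) (lam_N_hat W Q u K M j) (lam_S_hat Wt Q S u K M j)"

definition eta2_hat ::
    "real ^ 'n ^ 'n \<Rightarrow> real ^ 'n ^ 'n \<Rightarrow> real ^ 'n ^ 'n \<Rightarrow> nat \<Rightarrow> 'n::finite set \<Rightarrow>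
     ('n \<Rightarrow> nat \<Rightarrow> real) \<Rightarrow> ('n \<Rightarrow> nat \<Rightarrow> real) \<Rightarrow> nat \<Rightarrow> nat \<Rightarrow> 'n \<Rightarrow> real" where
  "eta2_hat Wc W Wt Q S c u K M j =
     eta2_of S K M (lam_M_hat Wc Q c K M j) (lam_N_hat W Q u K M j) (lam_S_hat Wt Q S u K M j)"


section \<open>Quantized observations in the secure period\<close>

definition secure_bit ::
    "real \<Rightarrow> real \<Rightarrow> ('n \<Rightarrow> nat \<Rightarrow> 'w \<Rightarrow> real) \<Rightarrow> 'w \<Rightarrow> 'n \<Rightarrow> nat \<Rightarrow> real" where
  "secure_bit \<tau> \<theta> noise \<omega> j m = of_bool (\<theta> + noise j m \<omega> > \<tau>)"

end

theory Submission
  imports Defs "HOL-Real_Asymp.Real_Asymp"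
begin

text \<open>
  Both statistics and both estimators tend to \<open>0\<close>, so the limits in question are \<open>0\<close> while the
  bound is nonnegative. Write \<open>m = M N\<close> and \<open>w = m - x\<close>, where \<open>x\<close> is the count (exact or
  estimated) of ones in the secure period. Expanding the logarithms turns \<open>eta1_of\<close> into a sum of
  terms \<open>t ln (1 + c / t)\<close> with \<open>t \<in> {m, x, w}\<close>, whose limits \<open>c\<close> add up to \<open>0\<close>. This needs only
  \<open>x \<rightarrow> \<infinity>\<close> and \<open>w \<rightarrow> \<infinity>\<close> (no law of large numbers), that is, almost surely infinitely many ones
  and zeros. The estimate of \<open>x\<close> differs from \<open>x\<close> by a bounded amount, because weights with second
  singular value below \<open>1\<close> contract the orthogonal complement of the all-one vector; the other two
  estimates do not depend on \<open>M\<close>.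
\<close>

section \<open>Contraction on the orthogonal complement of the all-one vector\<close>

text \<open>Rayleigh quotient argument: \<open>norm (V *v x)\<close> attains its maximum
  \<open>s\<close> over the compact unit sphere of the complement of \<open>1\<close>. A maximiser
  is an eigenvector of \<open>transpose V ** V\<close> with eigenvalue \<open>s\<^sup>2\<close>, so
  \<open>noeig\<close> leaves only \<open>s < 1\<close>, and \<open>r = s\<close> works.\<close>

lemma contraction_if_no_sv_eigenvector:
  fixes V :: "real ^ 'n ^ 'n"
  assumes row: "1 v* V = 1" and col: "V *v 1 = 1"
    and noeig: "\<And>s x. \<lbrakk>s \<ge> 1; x \<noteq> 0; x \<bullet> 1 = 0\<rbrakk> \<Longrightarrow> x \<notin> sv_eigenspace V s"
  shows "\<exists>r. 0 \<le> r \<and> r < 1 \<and> (\<forall>x. x \<bullet> 1 = 0 \<longrightarrow> norm (V *v x) \<le> r * norm x)"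
proof -
  define T where "T = {x :: real ^ 'n. x \<bullet> 1 = 0}"
  define C where "C = sphere 0 1 \<inter> T"
  have "closed T"
    unfolding T_def by (intro closed_Collect_eq continuous_intros)
  then have "compact C"
    unfolding C_def by (intro compact_Int_closed) auto
  show ?thesis
  proof (cases "C = {}")
    \<comment> \<open>The complement of \<open>1\<close> is trivial, as in dimension one; any rate
      works, so take \<open>0\<close>.\<close>
    case True
    have "x = 0" if "x \<bullet> 1 = 0" for x :: "real ^ 'n"
    proof (rule ccontr)
      assume "x \<noteq> 0"
      then have "(1 / norm x) *\<^sub>R x \<in> C"
        using that by (simp add: C_def T_def)
      with True show False by simp
    qed
    then have "norm (V *v x) \<le> 0 * norm x" if "x \<bullet> 1 = 0" for x
      using that by (metis matrix_vector_mult_0_right mult_zero_left norm_zero order_refl)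
    then show ?thesis
      by (intro exI[of _ 0]) simp
  next
    case False
    have "continuous_on C (\<lambda>x. norm (V *v x))"
      by (intro continuous_intros matrix_vector_mult_linear_continuous_on)
    with \<open>compact C\<close> False obtain a where a: "a \<in> C"
      and amax: "\<And>x. x \<in> C \<Longrightarrow> norm (V *v x) \<le> norm (V *v a)"
      using continuous_attains_sup by metis
    define s where "s = norm (V *v a)"
    have na: "norm a = 1" and aT: "a \<bullet> 1 = 0"
      using a by (auto simp: C_def T_def)
    have bound: "norm (V *v x) \<le> s * norm x" if "x \<bullet> 1 = 0" for x
    proof (cases "x = 0")
      case False
      then have "(1 / norm x) *\<^sub>R x \<in> C"
        using that by (simp add: C_def T_def)
      from amax[OF this] False show ?thesis
        by (simp add: s_def matrix_vector_mult_scaleR field_simps)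
    qed simp
    \<comment> \<open>The maximiser \<open>a\<close> is an eigenvector of \<open>B\<close>: moving from \<open>a\<close> in the direction of the residual
      \<open>w\<close> would otherwise exceed the maximum.\<close>
    define B where "B = transpose V ** V"
    have B_inner: "(B *v x) \<bullet> y = (V *v x) \<bullet> (V *v y)" for x y
      by (simp add: B_def transpose_matrix_vector dot_lmul_matrix flip: matrix_vector_mul_assoc)
    define w where "w = s\<^sup>2 *\<^sub>R a - B *v a"
    \<comment> \<open>\<open>col\<close> and \<open>row\<close> keep \<open>B *v a\<close>, hence
      \<open>w\<close>, orthogonal to \<open>1\<close>, so that \<open>bound\<close> applies to all
      \<open>a + t *\<^sub>R w\<close>.\<close>
    have "(B *v a) \<bullet> 1 = (1 v* V) \<bullet> a"
      unfolding B_inner col dot_lmul_matrix by (rule inner_commute)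
    then have wT: "w \<bullet> 1 = 0"
      by (simp add: w_def inner_diff_left aT row inner_commute[of 1 a])
    define g where "g = s\<^sup>2 * (w \<bullet> w) - (V *v w) \<bullet> (V *v w)"
    have expand: "(norm (x + t *\<^sub>R y))\<^sup>2 = (norm x)\<^sup>2 + 2 * t * (x \<bullet> y) + t\<^sup>2 * (y \<bullet> y)"
      for x y :: "real ^ 'n" and t
      unfolding power2_norm_eq_inner inner_add_left inner_add_right inner_scaleR_left inner_scaleR_right
        inner_commute[of y x] by (simp add: power2_eq_square algebra_simps)
    \<comment> \<open>Square \<open>bound\<close> at \<open>a + t *\<^sub>R w\<close>. The constant
      terms cancel because \<open>norm a = 1\<close> and \<open>s\<close> is attained at
      \<open>a\<close>; the linear coefficient is \<open>2 * (w \<bullet> w)\<close> by the choice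
      of \<open>w\<close>.\<close>
    have quad: "0 \<le> 2 * t * (w \<bullet> w) + t\<^sup>2 * g" for t
    proof -
      have "(a + t *\<^sub>R w) \<bullet> 1 = 0"
        by (simp add: inner_add_left aT wT)
      then have "(norm (V *v (a + t *\<^sub>R w)))\<^sup>2 \<le> s\<^sup>2 * (norm (a + t *\<^sub>R w))\<^sup>2"
        unfolding power_mult_distrib [symmetric] by (intro power_mono bound norm_ge_zero)
      moreover have "(norm (V *v (a + t *\<^sub>R w)))\<^sup>2
          = s\<^sup>2 + 2 * t * ((B *v a) \<bullet> w) + t\<^sup>2 * ((V *v w) \<bullet> (V *v w))"
        unfolding B_inner s_def matrix_vector_right_distrib matrix_vector_mult_scaleR by (rule expand)
      moreover have "(norm (a + t *\<^sub>R w))\<^sup>2 = 1 + 2 * t * (a \<bullet> w) + t\<^sup>2 * (w \<bullet> w)"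
        unfolding expand na by simp
      ultimately have "0 \<le> 2 * t * (s\<^sup>2 * (a \<bullet> w) - (B *v a) \<bullet> w) + t\<^sup>2 * g"
        by (simp add: g_def distrib_left right_diff_distrib mult.assoc mult.left_commute)
      moreover have "w \<bullet> w = s\<^sup>2 * (a \<bullet> w) - (B *v a) \<bullet> w"
        by (subst (1) w_def) (simp add: inner_diff_left)
      ultimately show ?thesis
        by simp
    qed
    have "w = 0"
    proof (rule ccontr)
      assume "w \<noteq> 0"
      then have d: "w \<bullet> w > 0" by simp
      have "norm (V *v w) ^ 2 \<le> (s * norm w) ^ 2"
        using bound[OF wT] by (intro power_mono) auto
      then have g: "g \<ge> 0"
        by (simp add: g_def power_mult_distrib power2_norm_eq_inner)
      \<comment> \<open>For small negative \<open>t\<close> the linear term dominates. This choice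
        gives \<open>t * g \<ge> - (w \<bullet> w)\<close>, and the \<open>+ 1\<close> covers
        \<open>g = 0\<close>.\<close>
      define t where "t = - (w \<bullet> w) / (g + 1)"
      have "t < 0" using d g by (simp add: t_def)
      moreover have "2 * (w \<bullet> w) + t * g > 0"
      proof -
        have "t * g = - (w \<bullet> w) * (g / (g + 1))"
          by (simp add: t_def)
        moreover have "(w \<bullet> w) * (g / (g + 1)) \<le> (w \<bullet> w) * 1"
          using d g by (intro mult_left_mono) auto
        ultimately show ?thesis using d by linarith
      qed
      ultimately have "t * (2 * (w \<bullet> w) + t * g) < 0"
        by (rule mult_neg_pos)
      with quad[of t] show False
        by (simp add: algebra_simps power2_eq_square)
    qed
    then have "a \<in> sv_eigenspace V s"
      by (simp add: sv_eigenspace_def w_def B_def)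
    then have "s < 1"
      using noeig[of s a] aT na by fastforce
    then show ?thesis
      using bound by (intro exI[of _ s]) (auto simp: s_def)
  qed
qed

text \<open>The list is descending: if entry number \<open>i\<close> were below \<open>t\<close>, so
  would be all later ones, leaving at most \<open>i - 1\<close> entries that reach
  \<open>t\<close>.\<close>

lemma sing_val_ge:
  assumes "i \<ge> 1" "i \<le> size (filter_mset (\<lambda>s. t \<le> s) (singular_values V))"
  shows "t \<le> sing_val i V"
proof (rule ccontr)
  define xs where "xs = rev (sorted_list_of_multiset (singular_values V))"
  let ?P = "\<lambda>s. t \<le> s"
  have mset_xs: "mset xs = singular_values V"
    by (simp add: xs_def)
  have len: "length (filter ?P xs) = size (filter_mset ?P (singular_values V))"
    "length xs = size (singular_values V)"
    unfolding mset_xs [symmetric] by (simp_all flip: mset_filter)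
  then have sz: "i \<le> length xs"
    using assms(2) length_filter_le[of ?P xs] by linarith
  assume "\<not> t \<le> sing_val i V"
  with assms(1) sz len(2) have small: "xs ! (i - 1) < t"
    by (simp add: sing_val_def xs_def)
  have "sorted_wrt (\<ge>) xs"
    by (simp add: xs_def sorted_wrt_rev)
  have "\<not> t \<le> x" if "x \<in> set (drop (i - 1) xs)" for x
  proof -
    obtain k where "k < length (drop (i - 1) xs)" "x = drop (i - 1) xs ! k"
      using \<open>x \<in> set (drop (i - 1) xs)\<close> unfolding in_set_conv_nth by blast
    then have k: "i - 1 + k < length xs" "x = xs ! (i - 1 + k)"
      using sz by auto
    have "x \<le> xs ! (i - 1)"
      using sorted_wrt_nth_less[OF \<open>sorted_wrt (\<ge>) xs\<close>, of "i - 1" "i - 1 + k"] k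
      by (cases k) auto
    with small show ?thesis by simp
  qed
  then have "filter ?P (drop (i - 1) xs) = []"
    by (simp add: filter_empty_conv)
  then have "length (filter ?P xs) \<le> i - 1"
    using length_filter_le[of ?P "take (i - 1) xs"]
      filter_append[of ?P "take (i - 1) xs" "drop (i - 1) xs"]
    unfolding append_take_drop_id by simp
  then show False
    using assms len(1) by linarith
qed

text \<open>The all-one vector already contributes a singular value \<open>1\<close>. A singular
  vector orthogonal to it with value at least \<open>1\<close> would be a second one, counted with
  multiplicity, and push \<open>sing_val 2 V\<close> up to \<open>1\<close>. Later estimates need
  only some rate below \<open>1\<close>, so \<open>r\<close> is not identified with
  \<open>sing_val 2 V\<close>.\<close>

lemma consensus_contraction:
  fixes V :: "real ^ 'n ^ 'n"
  assumes "consensus_weights V"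
  shows "\<exists>r. 0 \<le> r \<and> r < 1 \<and> (\<forall>x. x \<bullet> 1 = 0 \<longrightarrow> norm (V *v x) \<le> r * norm x)"
proof (rule contraction_if_no_sv_eigenvector)
  show row: "1 v* V = 1" and col: "V *v 1 = 1"
    using assms by (auto simp: consensus_weights_def)
  define E where "E = {s. 0 \<le> s \<and> (\<exists>x. x \<noteq> 0 \<and> x \<in> sv_eigenspace V s)}"
  have sv: "singular_values V = (\<Sum>s\<in>E. replicate_mset (dim (sv_eigenspace V s)) s)"
    by (simp add: singular_values_def E_def)
  have "sing_val 2 V \<noteq> 0" "sing_val 2 V < 1"
    using assms by (auto simp: consensus_weights_def)
  \<comment> \<open>The empty multiset would give \<open>sing_val\<close> its default value
    \<open>0\<close>.\<close>
  then have "singular_values V \<noteq> {#}"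
    by (auto simp: sing_val_def split: if_splits)
  \<comment> \<open>An infinite \<open>E\<close> would make the defining sum the empty multiset.\<close>
  then have "finite E"
    unfolding sv by (rule contrapos_np) simp
  have count: "count (singular_values V) s = dim (sv_eigenspace V s)" if "s \<in> E" for s
    unfolding sv count_sum using \<open>finite E\<close> that
    by (simp add: sum.delta)
  have one: "1 \<in> sv_eigenspace V 1"
    using row col
    by (simp add: sv_eigenspace_def transpose_matrix_vector flip: matrix_vector_mul_assoc)
  have one_nz: "(1 :: real ^ 'n) \<noteq> 0"
    by (simp add: vec_eq_iff)
  have "1 \<in> E"
    unfolding E_def using one one_nz by (intro CollectI conjI exI[of _ 1]) simp_all
  fix s :: real and x :: "real ^ 'n"
  assume s: "s \<ge> 1" and x: "x \<noteq> 0" "x \<bullet> 1 = 0"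
  show "x \<notin> sv_eigenspace V s"
  proof
    assume xs: "x \<in> sv_eigenspace V s"
    then have "s \<in> E"
      using s x by (auto simp: E_def)
    let ?D = "filter_mset (\<lambda>s. 1 \<le> s) (singular_values V)"
    have "2 \<le> size ?D"
    \<comment> \<open>If \<open>s = 1\<close>, the orthogonal vectors \<open>1\<close> and
      \<open>x\<close> share an eigenspace and the multiplicity of \<open>1\<close> is at least two;
      otherwise \<open>1\<close> and \<open>s\<close> are two different members.\<close>
    proof (cases "s = 1")
      case True
      have "pairwise orthogonal {1, x}"
        using x by (simp add: pairwise_insert orthogonal_def inner_commute[of 1 x])
      then have "independent {1, x}"
        by (rule pairwise_orthogonal_independent) (use one_nz x in simp)
      moreover have "card {1, x} = 2"
        using x one_nz by (cases "x = 1") simp_all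
      ultimately have "2 \<le> dim (sv_eigenspace V 1)"
        using True xs one independent_card_le_dim[of "{1, x}" "sv_eigenspace V 1"]
        by simp
      also have "\<dots> = count ?D 1"
        using count[OF \<open>1 \<in> E\<close>] by simp
      also have "\<dots> \<le> size ?D"
        by (rule count_le_size)
      finally show ?thesis .
    next
      case False
      have pos: "t \<in># ?D" if "t \<in> E" "t \<ge> 1" for t
      proof -
        obtain y where "y \<noteq> 0" "y \<in> sv_eigenspace V t"
          using \<open>t \<in> E\<close> by (auto simp: E_def)
        then have "dim (sv_eigenspace V t) \<noteq> 0"
          by auto
        then have "t \<in># singular_values V"
          unfolding count[OF \<open>t \<in> E\<close>, symmetric] by (simp add: count_eq_zero_iff)
        then show ?thesis
          using \<open>t \<ge> 1\<close> by simp
      qed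
      obtain D where D: "?D = add_mset 1 D"
        using multi_member_split[OF pos[OF \<open>1 \<in> E\<close> order_refl]] by (elim exE)
      then have "s \<in># D"
        using False pos[OF \<open>s \<in> E\<close> s] unfolding D by simp
      then obtain D' where "D = add_mset s D'"
        using multi_member_split by metis
      then show ?thesis
        unfolding D by simp
    qed
    then have "1 \<le> sing_val 2 V"
      by (intro sing_val_ge) auto
    with \<open>sing_val 2 V < 1\<close> show False by simp
  qed
qed

section \<open>Errors of the running-consensus estimates\<close>

lemma mat_pow_vector: "mat_pow V n *v x = ((*v) V ^^ n) x"
  by (induction n) (auto simp: mat_pow_def simp flip: matrix_vector_mul_assoc)

text \<open>Split \<open>x\<close> into its mean times \<open>1\<close> and a remainder
  \<open>d\<close> orthogonal to \<open>1\<close>. Powers of \<open>V\<close> fix the first part,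
  which accounts for the exact sum, and shrink \<open>d\<close> by \<open>r\<close> in each
  step.\<close>

lemma mat_pow_consensus_error:
  fixes V :: "real ^ 'n ^ 'n" and x :: "real ^ 'n"
  assumes row: "1 v* V = 1" and col: "V *v 1 = 1" and "0 \<le> r"
    and contr: "\<And>x. x \<bullet> 1 = 0 \<Longrightarrow> norm (V *v x) \<le> r * norm x"
    and le1: "\<And>i. \<bar>x $ i\<bar> \<le> 1"
  shows "\<bar>real CARD('n) * ((mat_pow V n *v x) $ j) - (\<Sum>i\<in>UNIV. x $ i)\<bar> \<le> 2 * (real CARD('n))\<^sup>2 * r ^ n"
proof -
  let ?N = "real CARD('n)"
  define a where "a = (\<Sum>i\<in>UNIV. x $ i) / ?N"
  define d where "d = x - a *\<^sub>R 1"
  have "d \<bullet> 1 = 0"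
    by (simp add: d_def a_def inner_vec_def sum_subtractf)
  then have "((*v) V ^^ n) d \<bullet> 1 = 0 \<and> norm (((*v) V ^^ n) d) \<le> r ^ n * norm d"
  \<comment> \<open>Orthogonality is carried along because \<open>contr\<close> holds only there;
    \<open>row\<close> preserves it.\<close>
  proof (induction n)
    case (Suc n)
    let ?y = "((*v) V ^^ n) d"
    have "(V *v ?y) \<bullet> 1 = ?y \<bullet> (1 v* V)"
      by (metis dot_lmul_matrix inner_commute)
    then have "(V *v ?y) \<bullet> 1 = 0"
      using Suc row by simp
    moreover have "norm (V *v ?y) \<le> r * (r ^ n * norm d)"
      using Suc contr[of ?y] \<open>0 \<le> r\<close> by (meson mult_left_mono order.trans)
    ultimately show ?case by simp
  qed simp
  then have "norm (mat_pow V n *v d) \<le> r ^ n * norm d"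
    by (simp add: mat_pow_vector)
  then have dn: "\<bar>(mat_pow V n *v d) $ j\<bar> \<le> r ^ n * norm d"
    using component_le_norm_cart order.trans by blast
  have "mat_pow V n *v 1 = 1"
    unfolding mat_pow_vector by (induction n) (auto simp: col)
  moreover have "x = a *\<^sub>R 1 + d"
    by (simp add: d_def)
  ultimately have "mat_pow V n *v x = a *\<^sub>R 1 + mat_pow V n *v d"
    by (metis matrix_vector_mult_scaleR matrix_vector_right_distrib)
  then have "?N * ((mat_pow V n *v x) $ j) - (\<Sum>i\<in>UNIV. x $ i) = ?N * ((mat_pow V n *v d) $ j)"
    by (simp add: a_def algebra_simps)
  also have "\<bar>\<dots>\<bar> \<le> ?N * (r ^ n * norm d)"
    using dn by (simp add: abs_mult mult_left_mono)
  also have "\<dots> \<le> ?N * (r ^ n * (2 * ?N))"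
  \<comment> \<open>The mean and the entries of \<open>x\<close> are at most \<open>1\<close> in
    modulus, so each of the \<open>CARD('n)\<close> entries of \<open>d\<close> is at most
    \<open>2\<close>; this is the source of the constant.\<close>
  proof (intro mult_left_mono)
    have "\<bar>\<Sum>i\<in>UNIV. x $ i\<bar> \<le> (\<Sum>i\<in>(UNIV :: 'n set). 1)"
      by (rule order.trans[OF sum_abs]) (intro sum_mono le1)
    then have a1: "\<bar>a\<bar> \<le> 1"
      by (simp add: a_def)
    have "norm d \<le> (\<Sum>i\<in>UNIV. \<bar>d $ i\<bar>)"
      by (rule norm_le_l1_cart)
    also have "\<dots> \<le> (\<Sum>i\<in>(UNIV :: 'n set). 2)"
    proof (rule sum_mono)
      fix i
      show "\<bar>d $ i\<bar> \<le> 2"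
        using a1 le1[of i] by (simp add: d_def)
    qed
    finally show "norm d \<le> 2 * ?N" by simp
  qed (use \<open>0 \<le> r\<close> in auto)
  finally show ?thesis
    by (simp add: power2_eq_square algebra_simps)
qed

text \<open>A bit received at time \<open>l\<close> has been mixed at least \<open>M - l\<close>
  times by time \<open>M + K\<close>. The errors are therefore dominated by a geometric series whose
  sum does not depend on \<open>M\<close>.\<close>

lemma lam_M_hat_error_bounded:
  fixes V :: "real ^ 'n ^ 'n"
  assumes V: "consensus_weights V" and "Q \<ge> 1" and c: "\<And>i m. \<bar>c i m\<bar> \<le> 1"
  shows "\<exists>B. \<forall>M. \<bar>lam_M_hat V Q c K M j - lam_M c M\<bar> \<le> B"
proof -
  let ?N = "real CARD('n)"
  obtain r where r: "0 \<le> r" "r < 1"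
    and contr: "\<And>x. x \<bullet> 1 = 0 \<Longrightarrow> norm (V *v x) \<le> r * norm x"
    using consensus_contraction[OF V] by blast
  have row: "1 v* V = 1" and col: "V *v 1 = 1"
    using V by (auto simp: consensus_weights_def)
  have "\<bar>lam_M_hat V Q c K M j - lam_M c M\<bar> \<le> 2 * ?N\<^sup>2 * (1 / (1 - r))" for M
  proof -
    let ?e = "\<lambda>l. Q * (M + K - l + 1)"
    let ?x = "\<lambda>l. \<chi> i. c i l"
    have "consensus_state V Q (input_M c M) (M + K)
        = (\<Sum>l=1..M + K. if l \<le> M then mat_pow V (?e l) *v ?x l else 0)"
      unfolding consensus_state_def
      by (intro sum.cong refl) (auto simp: input_M_def zero_vec_def [symmetric])
    also have "\<dots> = (\<Sum>l=1..M. mat_pow V (?e l) *v ?x l)"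
      by (intro sum.mono_neutral_cong_right) auto
    finally have "lam_M_hat V Q c K M j - lam_M c M
        = (\<Sum>l=1..M. ?N * ((mat_pow V (?e l) *v ?x l) $ j) - (\<Sum>i\<in>UNIV. ?x l $ i))"
      unfolding lam_M_hat_def lam_M_def
      by (subst sum.swap) (simp add: sum_subtractf sum_distrib_left)
    also have "\<bar>\<dots>\<bar> \<le> (\<Sum>l=1..M. 2 * ?N\<^sup>2 * r ^ (M - l))"
    proof (rule order.trans[OF sum_abs], rule sum_mono)
      fix l
      have "\<bar>?N * ((mat_pow V (?e l) *v ?x l) $ j) - (\<Sum>i\<in>UNIV. ?x l $ i)\<bar> \<le> 2 * ?N\<^sup>2 * r ^ ?e l"
        by (rule mat_pow_consensus_error[OF row col r(1) contr]) (use c in auto)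
      \<comment> \<open>The exponent is lowered to \<open>M - l\<close>, which is legitimate for
        \<open>r < 1\<close> and makes the reversed sum a plain geometric one.\<close>
      moreover have "M - l \<le> 1 * (M + K - l + 1)" by simp
      then have "M - l \<le> ?e l"
        using \<open>Q \<ge> 1\<close> by (meson mult_le_mono1 order.trans)
      then have "r ^ ?e l \<le> r ^ (M - l)"
        using r by (intro power_decreasing) auto
      ultimately show "\<bar>?N * ((mat_pow V (?e l) *v ?x l) $ j) - (\<Sum>i\<in>UNIV. ?x l $ i)\<bar> \<le> 2 * ?N\<^sup>2 * r ^ (M - l)"
        by (meson mult_left_mono order.trans zero_le_mult_iff zero_le_numeral zero_le_power2)
    qed
    also have "\<dots> = 2 * ?N\<^sup>2 * (\<Sum>k<M. r ^ k)"
      unfolding sum_distrib_left [symmetric]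
      by (rule arg_cong[where f = "\<lambda>x. 2 * ?N\<^sup>2 * x"],
          rule sum.reindex_bij_witness[of _ "\<lambda>k. M - k" "\<lambda>l. M - l"]) auto
    also have "\<dots> \<le> 2 * ?N\<^sup>2 * (1 / (1 - r))"
    proof (rule mult_left_mono)
      show "(\<Sum>k<M. r ^ k) \<le> 1 / (1 - r)"
        using r by (simp add: sum_gp_strict divide_right_mono)
    qed auto
    finally show ?thesis .
  qed
  then show ?thesis by blast
qed

text \<open>Silent rounds leave the state at zero, and the exponent depends only on the age of an
  input. Hence the estimates of the counts after the secure period are constants as \<open>M\<close>
  grows.\<close>

lemma consensus_state_shift:
  assumes "\<And>l. l \<le> M \<Longrightarrow> g l = 0"
  shows "consensus_state V Q g (M + K) = consensus_state V Q (\<lambda>k. g (M + k)) K"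
proof -
  have "consensus_state V Q g (M + K)
      = (\<Sum>l\<in>{M + 1..M + K}. mat_pow V (Q * (M + K - l + 1)) *v g l)"
    unfolding consensus_state_def
    by (rule sum.mono_neutral_right) (auto simp: assms)
  also have "\<dots> = consensus_state V Q (\<lambda>k. g (M + k)) K"
    unfolding consensus_state_def
    by (rule sum.reindex_bij_witness[of _ "\<lambda>k. M + k" "\<lambda>l. l - M"]) (auto simp: add.commute)
  finally show ?thesis .
qed

lemma lam_N_hat_indep_M: "lam_N_hat V Q u K M j = lam_N_hat V Q u K 0 j"
proof -
  have "consensus_state V Q (input_N u M) (M + K) = consensus_state V Q (input_N u 0) K"
  proof (subst consensus_state_shift)
    have "input_N u M (M + k) = input_N u 0 k" if "k \<ge> 1" for k
      using that by (simp add: input_N_def vec_eq_iff)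
    then show "consensus_state V Q (\<lambda>k. input_N u M (M + k)) K = consensus_state V Q (input_N u 0) K"
      unfolding consensus_state_def by (intro sum.cong refl) simp
  qed (simp add: input_N_def vec_eq_iff)
  then show ?thesis by (simp add: lam_N_hat_def)
qed

lemma lam_S_hat_indep_M: "lam_S_hat V Q S u K M j = lam_S_hat V Q S u K 0 j"
proof -
  have "consensus_state V Q (input_S S u M) (M + K) = consensus_state V Q (input_S S u 0) K"
  proof (subst consensus_state_shift)
    have "input_S S u M (M + k) = input_S S u 0 k" if "k \<ge> 1" for k
      using that by (simp add: input_S_def vec_eq_iff)
    then show "consensus_state V Q (\<lambda>k. input_S S u M (M + k)) K = consensus_state V Q (input_S S u 0) K"
      unfolding consensus_state_def by (intro sum.cong refl) simp
  qed (simp add: input_S_def vec_eq_iff)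
  then show ?thesis by (simp add: lam_S_hat_def)
qed

section \<open>Limits of the statistics for diverging counts\<close>

lemma tendsto_mult_ln_one_plus:
  fixes f :: "nat \<Rightarrow> real"
  assumes "filterlim f at_top sequentially"
  shows "(\<lambda>n. f n * ln (1 + c / f n)) \<longlonglongrightarrow> c" and "(\<lambda>n. ln (1 + c / f n)) \<longlonglongrightarrow> 0"
proof -
  have "((\<lambda>x :: real. x * ln (1 + c / x)) \<longlongrightarrow> c) at_top"
    by real_asymp
  from filterlim_compose[OF this assms] show "(\<lambda>n. f n * ln (1 + c / f n)) \<longlonglongrightarrow> c" .
  have "((\<lambda>x :: real. ln (1 + c / x)) \<longlongrightarrow> 0) at_top"
    by real_asymp
  from filterlim_compose[OF this assms] show "(\<lambda>n. ln (1 + c / f n)) \<longlonglongrightarrow> 0" .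
qed

text \<open>The common factor \<open>X / m\<close> of both fractions cancels. It serves with
  \<open>X\<close> the number of ones and with \<open>X\<close> the number of zeros in the secure
  period.\<close>

lemma ln_ratio_expand:
  fixes X m a b z y :: real
  assumes "X > 0" "m > 0" "X + z > 0" "X + y > 0" "m + a > 0" "m + b > 0"
  shows "ln (((X + z) / (m + a)) / ((X + y) / (m + b)))
    = ln (1 + z / X) - ln (1 + a / m) - ln (1 + y / X) + ln (1 + b / m)"
proof -
  have "1 + z / X = (X + z) / X" "1 + y / X = (X + y) / X"
    "1 + a / m = (m + a) / m" "1 + b / m = (m + b) / m"
    using assms by (simp_all add: field_simps)
  then show ?thesis
    using assms by (simp add: ln_div ln_mult_pos)
qed

lemma eta_of_tendsto_zero:
  fixes S :: "'n::finite set" and x :: "nat \<Rightarrow> real" and y z :: real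
  assumes x: "filterlim x at_top sequentially"
    and x': "filterlim (\<lambda>M. real M * real CARD('n) - x M) at_top sequentially"
  shows "(\<lambda>M. eta1_of S K M (x M) y z) \<longlonglongrightarrow> 0"
    and "(\<lambda>M. eta2_of S K M (x M) y z) \<longlonglongrightarrow> 0"
proof -
  define m where "m = (\<lambda>M. real M * real CARD('n))"
  define a where "a = real K * real (card S)"
  define b where "b = real K * real CARD('n)"
  define w where "w = (\<lambda>M. m M - x M)"
  have w: "filterlim w at_top sequentially"
    using x' by (simp add: w_def m_def)
  have m: "filterlim m at_top sequentially"
    using filterlim_at_top_add_at_top[OF x w] by (simp add: w_def)
  \<comment> \<open>\<open>G1\<close> counts zeros: against \<open>z\<close> ones among
    \<open>a\<close> bits there are \<open>a - z\<close> zeros, and likewise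
    \<open>b - y\<close>.\<close>
  define g1 where "g1 = (\<lambda>M. ln (1 + (a - z) / w M) - ln (1 + a / m M) - ln (1 + (b - y) / w M) + ln (1 + b / m M))"
  define g2 where "g2 = (\<lambda>M. ln (1 + z / x M) - ln (1 + a / m M) - ln (1 + y / x M) + ln (1 + b / m M))"
  have ev: "\<forall>\<^sub>F M in sequentially. G1 S K M (x M) y z = g1 M \<and> G2 S K M (x M) y z = g2 M"
  proof -
    have big: "\<forall>\<^sub>F M in sequentially. f M > t" if "filterlim f at_top sequentially" for f :: "nat \<Rightarrow> real" and t
      using that by (simp add: filterlim_at_top_dense)
    \<comment> \<open>These thresholds make all four shifted numerators, and
      \<open>m M = x M + w M\<close>, positive, so that the logarithms split.\<close>
    have "\<forall>\<^sub>F M in sequentially. x M > max 0 (max (- y) (- z)) \<and> w M > max 0 (max (z - a) (y - b))"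
      by (intro eventually_conj big x w)
    then show ?thesis
    proof eventually_elim
      case (elim M)
      have ab: "a \<ge> 0" "b \<ge> 0"
        by (simp_all add: a_def b_def)
      have mM: "m M > 0" "m M = x M + w M"
        using elim by (simp_all add: w_def)
      have "1 - (x M + z) / (m M + a) = (w M + (a - z)) / (m M + a)"
        "1 - (x M + y) / (m M + b) = (w M + (b - y)) / (m M + b)"
        using mM ab by (simp_all add: field_simps)
      then have "G1 S K M (x M) y z = ln (((w M + (a - z)) / (m M + a)) / ((w M + (b - y)) / (m M + b)))"
        by (simp add: G1_def m_def a_def b_def)
      also have "\<dots> = g1 M"
        unfolding g1_def using elim mM ab by (intro ln_ratio_expand) auto
      finally have 1: "G1 S K M (x M) y z = g1 M" .
      have "G2 S K M (x M) y z = ln (((x M + z) / (m M + a)) / ((x M + y) / (m M + b)))"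
        by (simp add: G2_def m_def a_def b_def)
      also have "\<dots> = g2 M"
        unfolding g2_def using elim mM ab by (intro ln_ratio_expand) auto
      finally show ?case using 1 by simp
    qed
  qed
  note lims = tendsto_mult_ln_one_plus
  \<comment> \<open>The terms with denominator \<open>m M\<close> occur in both \<open>g1\<close>
    and \<open>g2\<close>; their weights \<open>w M\<close> and \<open>x M\<close> add up to
    \<open>m M\<close>. The six limits cancel.\<close>
  have "(\<lambda>M. w M * ln (1 + (a - z) / w M) + x M * ln (1 + z / x M)
      - w M * ln (1 + (b - y) / w M) - x M * ln (1 + y / x M)
      - m M * ln (1 + a / m M) + m M * ln (1 + b / m M)) \<longlonglongrightarrow> (a - z) + z - (b - y) - y - a + b"
    by (intro tendsto_add tendsto_diff lims(1) w x m)
  then have "(\<lambda>M. w M * g1 M + x M * g2 M) \<longlonglongrightarrow> 0"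
    by (simp add: g1_def g2_def w_def algebra_simps)
  moreover have "\<forall>\<^sub>F M in sequentially. w M * g1 M + x M * g2 M = eta1_of S K M (x M) y z"
    using ev by eventually_elim (simp add: eta1_of_def w_def m_def)
  ultimately show "(\<lambda>M. eta1_of S K M (x M) y z) \<longlonglongrightarrow> 0"
    by (rule Lim_transform_eventually)
  \<comment> \<open>In \<open>eta2_of\<close> the weights \<open>a - z\<close> and \<open>z\<close>
    stay bounded, so it suffices that each logarithm vanishes in the limit.\<close>
  have "g1 \<longlonglongrightarrow> 0 - 0 - 0 + 0" "g2 \<longlonglongrightarrow> 0 - 0 - 0 + 0"
    unfolding g1_def g2_def by (intro tendsto_add tendsto_diff lims(2) w x m)+
  then have "(\<lambda>M. (a - z) * g1 M + z * g2 M) \<longlonglongrightarrow> (a - z) * 0 + z * 0"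
    by (intro tendsto_intros) simp_all
  then have "(\<lambda>M. (a - z) * g1 M + z * g2 M) \<longlonglongrightarrow> 0"
    by simp
  moreover have "\<forall>\<^sub>F M in sequentially. (a - z) * g1 M + z * g2 M = eta2_of S K M (x M) y z"
    using ev by eventually_elim (simp add: eta2_of_def a_def)
  ultimately show "(\<lambda>M. eta2_of S K M (x M) y z) \<longlonglongrightarrow> 0"
    by (rule Lim_transform_eventually)
qed

section \<open>Almost sure divergence of the counts\<close>

lemma filterlim_sum_at_top_if_infinite:
  fixes b :: "nat \<Rightarrow> real"
  assumes nonneg: "\<And>m. 0 \<le> b m" and inf: "\<And>n. \<exists>m>n. 1 \<le> b m"
  shows "filterlim (\<lambda>M. \<Sum>m=1..M. b m) at_top sequentially"
  unfolding filterlim_at_top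
proof
  fix Z :: real
  have "infinite {m. 1 \<le> m \<and> 1 \<le> b m}"
    unfolding infinite_nat_iff_unbounded using inf
    by (metis One_nat_def Suc_leI gr_implies_not0 mem_Collect_eq not_gr_zero)
  then obtain A where A: "A \<subseteq> {m. 1 \<le> m \<and> 1 \<le> b m}" "finite A" "card A = nat \<lceil>Z\<rceil>"
    using infinite_arbitrarily_large by blast
  \<comment> \<open>Inserting \<open>0\<close> keeps \<open>Max\<close> meaningful when
    \<open>A\<close> is empty, which happens for \<open>Z \<le> 0\<close>.\<close>
  have "Z \<le> (\<Sum>m=1..M. b m)" if "M \<ge> Max (insert 0 A)" for M
  proof -
    have sub: "A \<subseteq> {1..M}"
      using A that by auto
    have "Z \<le> (\<Sum>m\<in>A. 1)"
      using A(3) by simp linarith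
    also have "\<dots> \<le> (\<Sum>m\<in>A. b m)"
      using A(1) by (intro sum_mono) auto
    also have "\<dots> \<le> (\<Sum>m=1..M. b m)"
      using sub nonneg by (intro sum_mono2) auto
    finally show ?thesis .
  qed
  then show "\<forall>\<^sub>F M in sequentially. Z \<le> (\<Sum>m=1..M. b m)"
    by (auto simp: eventually_sequentially)
qed

text \<open>By independence, \<open>k + 1\<close> of the variables lie in \<open>A\<close> together
  with probability \<open>p ^ Suc k\<close>, which tends to \<open>0\<close>. The injection
  \<open>f\<close> selects countably many indices, so the limiting event is measurable.\<close>

lemma (in prob_space) AE_indep_vars_escape:
  assumes indep: "indep_vars (\<lambda>_. N) X I" and "infinite I" and A: "A \<in> sets N"
    and prob: "\<And>i. i \<in> I \<Longrightarrow> prob (X i -` A \<inter> space M) = p" and "p < 1"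
  shows "AE \<omega> in M. \<exists>i\<in>I. X i \<omega> \<notin> A"
proof -
  obtain f :: "nat \<Rightarrow> 'b" where f: "inj f" "range f \<subseteq> I"
    using infinite_countable_subset[OF \<open>infinite I\<close>] by blast
  have meas: "X i -` A \<inter> space M \<in> events" if "i \<in> I" for i
    using indep that A by (auto simp: indep_vars_def)
  define C where "C = (\<Inter>n. X (f n) -` A \<inter> space M)"
  have C: "C \<in> events"
    unfolding C_def using meas f(2) by (intro sets.countable_INT) auto
  have le: "prob C \<le> p ^ Suc k" for k
  proof -
    have "prob C \<le> prob (\<Inter>i\<in>f ` {..k}. X i -` A \<inter> space M)"
      using meas f(2) by (intro finite_measure_mono sets.finite_INT) (auto simp: C_def)
    also have "\<dots> = (\<Prod>i\<in>f ` {..k}. prob (X i -` A \<inter> space M))"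
      using f(2) A by (intro indep_varsD[OF indep]) auto
    also have "\<dots> = (\<Prod>i\<in>f ` {..k}. p)"
      using f(2) prob by (intro prod.cong) auto
    also have "\<dots> = p ^ Suc k"
      using f(1) by (simp add: card_image inj_on_subset)
    finally show ?thesis .
  qed
  have "0 \<le> p"
    using prob[of "f 0"] f(2) measure_nonneg by (metis rangeI subsetD)
  then have "(\<lambda>k. p ^ Suc k) \<longlonglongrightarrow> 0"
    using \<open>p < 1\<close> by (intro LIMSEQ_Suc LIMSEQ_power_zero) auto
  then have "prob C \<le> 0"
    using le by (intro LIMSEQ_le_const) auto
  then have "prob C = 0"
    using measure_nonneg by (metis order_antisym)
  then have "C \<in> null_sets M"
    using C by (simp add: null_sets_def emeasure_eq_measure)
  then show ?thesis
    by (rule AE_I') (use f(2) in \<open>auto simp: C_def\<close>)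
qed

text \<open>Every tail of the sequence is again an infinite independent family, so the escape
  argument applies to each of the countably many tails.\<close>

lemma (in prob_space) AE_indep_vars_infinitely_often:
  fixes X :: "'i \<Rightarrow> nat \<Rightarrow> 'a \<Rightarrow> 'b"
  assumes indep: "indep_vars (\<lambda>_. N) (\<lambda>(i, m). X i m) (UNIV \<times> {1..})" and A: "A \<in> sets N"
    and prob: "\<And>m. m \<ge> 1 \<Longrightarrow> prob (X i m -` A \<inter> space M) = p" and "p < 1"
  shows "AE \<omega> in M. \<forall>n. \<exists>m>n. X i m \<omega> \<notin> A"
  unfolding AE_all_countable
proof
  fix n :: nat
  \<comment> \<open>Even for \<open>n = 0\<close> the tail starts at \<open>1\<close>, inside the
    index set of \<open>indep\<close>.\<close>
  have "infinite ({i} \<times> {n<..})"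
    by (simp add: finite_cartesian_product_iff infinite_Ioi)
  with indep have "AE \<omega> in M. \<exists>k\<in>{i} \<times> {n<..}. (\<lambda>(i, m). X i m) k \<omega> \<notin> A"
    by (intro AE_indep_vars_escape[where p = p and N = N] indep_vars_subset[OF indep] A \<open>p < 1\<close>)
      (auto intro: prob)
  then show "AE \<omega> in M. \<exists>m>n. X i m \<omega> \<notin> A"
    by eventually_elim auto
qed

text \<open>A single sensor suffices, since its own count is a lower bound. Applied to
  \<open>c\<close> it handles the ones, applied to \<open>1 - c\<close> the zeros.\<close>

lemma lam_M_at_top:
  fixes c :: "'n::finite \<Rightarrow> nat \<Rightarrow> real"
  assumes "\<And>i m. 0 \<le> c i m" and "\<And>n. \<exists>m>n. 1 \<le> c j m"
  shows "filterlim (lam_M c) at_top sequentially"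
proof (rule filterlim_at_top_mono)
  show "filterlim (\<lambda>M. \<Sum>m=1..M. c j m) at_top sequentially"
    using assms by (intro filterlim_sum_at_top_if_infinite) auto
  show "\<forall>\<^sub>F M in sequentially. (\<Sum>m=1..M. c j m) \<le> lam_M c M"
    unfolding lam_M_def
    by (intro always_eventually allI member_le_sum) (auto intro: sum_nonneg assms)
qed

section \<open>Almost sure limits of the estimation errors\<close>

theorem theorem4:
  fixes P :: "'w measure"
    and F :: "real \<Rightarrow> real"
    and \<tau> \<theta> :: real
    and noise :: "'n::finite \<Rightarrow> nat \<Rightarrow> 'w \<Rightarrow> real"
    and u :: "'n \<Rightarrow> nat \<Rightarrow> 'w \<Rightarrow> real"
    and S :: "'n set"
    and Wc W Wt :: "real ^ 'n ^ 'n"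
    and Q K :: nat
    and j :: 'n
  defines "q \<equiv> F (\<tau> - \<theta>)"
  assumes "prob_space P"
    and "continuous_on UNIV F" and "strict_mono F" and "bij_betw F UNIV {0<..<1}"
    and "prob_space.indep_vars P (\<lambda>_. borel) (\<lambda>(i, m). noise i m) (UNIV \<times> {1..})"
    and "\<And>i m. m \<ge> 1 \<Longrightarrow> cdf (distr P borel (noise i m)) = F"
    and "\<And>i k \<omega>. k \<ge> 1 \<Longrightarrow> \<omega> \<in> space P \<Longrightarrow> u i k \<omega> \<in> {0, 1}"
    and "consensus_weights Wc" and "consensus_weights W" and "consensus_weights Wt"
    and "Q \<ge> 1"
  shows
    "(AE \<omega> in P.
        let c = secure_bit \<tau> \<theta> noise \<omega>;
            v = (\<lambda>i k. u i k \<omega>);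
            D1 = (\<lambda>M. \<bar>eta1_hat Wc W Wt Q S c v K M j - eta1 S c v K M\<bar>)
        in convergent D1 \<and>
           lim D1 \<le> (real CARD('n))\<^sup>2 * (2 - q) / (q * (1 - q)) *
                    (2 * ratio_term Q Wc + ratio_term Q Wt + ratio_term Q W))
     \<and>
     (AE \<omega> in P.
        let c = secure_bit \<tau> \<theta> noise \<omega>;
            v = (\<lambda>i k. u i k \<omega>)
        in (\<lambda>M. \<bar>eta2_hat Wc W Wt Q S c v K M j - eta2 S c v K M\<bar>) \<longlonglongrightarrow> 0)"
proof -
  interpret prob_space P by fact
  let ?t = "\<tau> - \<theta>"
  have q: "0 < q" "q < 1"
    using \<open>bij_betw F UNIV {0<..<1}\<close> by (auto simp: q_def bij_betw_def)
  have meas: "noise i m \<in> borel_measurable P" if "m \<ge> 1" for i m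
    using assms(6) that by (auto simp: indep_vars_def)
  have le: "prob (noise i m -` {..?t} \<inter> space P) = q" if "m \<ge> 1" for i m
    using assms(7)[OF that, of i] meas[OF that, of i] by (simp add: q_def cdf_def measure_distr fun_eq_iff)
  have gt: "prob (noise i m -` {?t<..} \<inter> space P) = 1 - q" if "m \<ge> 1" for i m
  proof -
    have "noise i m -` {?t<..} \<inter> space P = space P - (noise i m -` {..?t} \<inter> space P)"
      by auto
    then show ?thesis
      using le[OF that, of i] meas[OF that, of i] by (simp add: prob_compl measurable_sets)
  qed
  \<comment> \<open>A bit is \<open>1\<close> exactly when the noise leaves
    \<open>{..\<tau> - \<theta>}\<close>, and \<open>0\<close> exactly when it leaves the
    complement. Staying inside has probability \<open>q\<close> or \<open>1 - q\<close>, both below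
    \<open>1\<close>.\<close>
  have ones: "AE \<omega> in P. \<forall>n. \<exists>m>n. noise j m \<omega> \<notin> {..?t}"
    by (rule AE_indep_vars_infinitely_often[OF assms(6) _ le]) (use q in auto)
  have zeros: "AE \<omega> in P. \<forall>n. \<exists>m>n. noise j m \<omega> \<notin> {?t<..}"
    by (rule AE_indep_vars_infinitely_often[OF assms(6) _ gt]) (use q in auto)
  have both: "AE \<omega> in P.
      (\<lambda>M. \<bar>eta1_hat Wc W Wt Q S (secure_bit \<tau> \<theta> noise \<omega>) (\<lambda>i k. u i k \<omega>) K M j
          - eta1 S (secure_bit \<tau> \<theta> noise \<omega>) (\<lambda>i k. u i k \<omega>) K M\<bar>) \<longlonglongrightarrow> 0 \<and>
      (\<lambda>M. \<bar>eta2_hat Wc W Wt Q S (secure_bit \<tau> \<theta> noise \<omega>) (\<lambda>i k. u i k \<omega>) K M j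
          - eta2 S (secure_bit \<tau> \<theta> noise \<omega>) (\<lambda>i k. u i k \<omega>) K M\<bar>) \<longlonglongrightarrow> 0"
    using ones zeros
  proof eventually_elim
    case (elim \<omega>)
    define c where "c = secure_bit \<tau> \<theta> noise \<omega>"
    define v where "v = (\<lambda>i k. u i k \<omega>)"
    have "1 \<le> c j m \<longleftrightarrow> noise j m \<omega> \<notin> {..?t}" "1 \<le> 1 - c j m \<longleftrightarrow> noise j m \<omega> \<notin> {?t<..}" for m
      by (auto simp: c_def secure_bit_def of_bool_def)
    with elim have inf: "\<And>n. \<exists>m>n. 1 \<le> c j m" "\<And>n. \<exists>m>n. 1 \<le> 1 - c j m"
      by auto
    have c01: "0 \<le> c i m" "c i m \<le> 1" for i m
      by (auto simp: c_def secure_bit_def)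
    have x: "filterlim (lam_M c) at_top sequentially"
      using c01 inf by (intro lam_M_at_top) auto
    have "filterlim (lam_M (\<lambda>i m. 1 - c i m)) at_top sequentially"
      using c01 inf by (intro lam_M_at_top) auto
    then have x': "filterlim (\<lambda>M. real M * real CARD('n) - lam_M c M) at_top sequentially"
      by (simp add: lam_M_def [abs_def] sum_subtractf mult.commute)
    obtain B where B: "\<And>M. \<bar>lam_M_hat Wc Q c K M j - lam_M c M\<bar> \<le> B"
      using lam_M_hat_error_bounded[OF \<open>consensus_weights Wc\<close> \<open>Q \<ge> 1\<close>, of c K j] c01
      by (auto simp: abs_le_iff intro: order.trans[of _ 0])
    \<comment> \<open>A bounded error does not affect divergence, so the estimated counts of ones
      and zeros diverge with the exact ones.\<close>
    have hx: "filterlim (\<lambda>M. lam_M_hat Wc Q c K M j) at_top sequentially"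
    proof (rule filterlim_at_top_mono)
      show "filterlim (\<lambda>M. - B + lam_M c M) at_top sequentially"
        by (rule filterlim_tendsto_add_at_top[OF tendsto_const x])
      show "\<forall>\<^sub>F M in sequentially. - B + lam_M c M \<le> lam_M_hat Wc Q c K M j"
        by (intro always_eventually allI) (use B in \<open>simp add: abs_le_iff algebra_simps\<close>)
    qed
    have hx': "filterlim (\<lambda>M. real M * real CARD('n) - lam_M_hat Wc Q c K M j) at_top sequentially"
    proof (rule filterlim_at_top_mono)
      show "filterlim (\<lambda>M. - B + (real M * real CARD('n) - lam_M c M)) at_top sequentially"
        by (rule filterlim_tendsto_add_at_top[OF tendsto_const x'])
      show "\<forall>\<^sub>F M in sequentially.
          - B + (real M * real CARD('n) - lam_M c M) \<le> real M * real CARD('n) - lam_M_hat Wc Q c K M j"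
        by (intro always_eventually allI) (use B in \<open>simp add: abs_le_iff algebra_simps\<close>)
    qed
    have hat: "(\<lambda>M. eta1_hat Wc W Wt Q S c v K M j) \<longlonglongrightarrow> 0"
      "(\<lambda>M. eta2_hat Wc W Wt Q S c v K M j) \<longlonglongrightarrow> 0"
      unfolding eta1_hat_def eta2_hat_def
      \<comment> \<open>Rewriting both estimates to their values at secure length \<open>0\<close>
        turns them into the constants \<open>y\<close> and \<open>z\<close> of the limit
        lemma.\<close>
      by (subst lam_N_hat_indep_M, subst lam_S_hat_indep_M, rule eta_of_tendsto_zero[OF hx hx'])+
    have exact: "eta1 S c v K \<longlonglongrightarrow> 0" "eta2 S c v K \<longlonglongrightarrow> 0"
      unfolding eta1_def [abs_def] eta2_def [abs_def] by (rule eta_of_tendsto_zero[OF x x'])+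
    note lims = tendsto_rabs[OF tendsto_diff[OF hat(1) exact(1)]]
      tendsto_rabs[OF tendsto_diff[OF hat(2) exact(2)]]
    from lims show ?case
      by (simp add: c_def v_def)
  qed
  \<comment> \<open>With limit \<open>0\<close> for the error, the stated bound only has to be
    nonnegative; this holds termwise as \<open>sing_val 2 V\<close> lies between \<open>0\<close>
    and \<open>1\<close>.\<close>
  have ratio: "0 \<le> ratio_term Q V" if "consensus_weights V" for V :: "real ^ 'n ^ 'n"
    using that by (simp add: ratio_term_def consensus_weights_def power_le_one)
  have bound: "0 \<le> (real CARD('n))\<^sup>2 * (2 - q) / (q * (1 - q)) *
      (2 * ratio_term Q Wc + ratio_term Q Wt + ratio_term Q W)"
    using q ratio assms(9-11)
    by (intro mult_nonneg_nonneg divide_nonneg_nonneg add_nonneg_nonneg) auto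
  show ?thesis
  proof
    show "AE \<omega> in P.
        let c = secure_bit \<tau> \<theta> noise \<omega>;
            v = (\<lambda>i k. u i k \<omega>);
            D1 = (\<lambda>M. \<bar>eta1_hat Wc W Wt Q S c v K M j - eta1 S c v K M\<bar>)
        in convergent D1 \<and>
           lim D1 \<le> (real CARD('n))\<^sup>2 * (2 - q) / (q * (1 - q)) *
                    (2 * ratio_term Q Wc + ratio_term Q Wt + ratio_term Q W)"
      using both
    proof eventually_elim
      case (elim \<omega>)
      then show ?case
        using bound by (auto simp: Let_def convergent_def limI)
    qed
    show "AE \<omega> in P.
        let c = secure_bit \<tau> \<theta> noise \<omega>;
            v = (\<lambda>i k. u i k \<omega>)
        in (\<lambda>M. \<bar>eta2_hat Wc W Wt Q S c v K M j - eta2 S c v K M\<bar>) \<longlonglongrightarrow> 0"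
      using both by eventually_elim (simp add: Let_def)
  qed
qed

end
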